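(* Let $0<\nu<2$, $b>0$ and $a\in\mathbb R$. If $|a|\le 1$, then $$\mathbf K_{N,\nu}(a,b)=\mathbf J_{N,\nu}\!\left(\tfrac14-a^2+b^2\right)^2+4a^2b^2I_{N+1}$$ is nonsingular and totally nonnegative for every integer $N\ge 0$. Conversely, if $|a|>1$, then for every fixed $b>0$ and every $0<\nu<2$, the matrix $\mathbf K_{N,\nu}(a,b)$ fails to be totally nonnegative for at least one $N$. Thus $|a|\le 1$ is the sharp range uniform in both $N$ and $\nu$.
   Context: A finite real matrix is totally nonnegative if all of its minors are nonnegative. $I_{N+1}$ is the identity matrix of size $N+1$. For $N\ge0$, $0<\nu<2$, $\alpha\in\mathbb R$, $\mathbf J_{N,\nu}(\alpha)$ is the $(N+1)\times(N+1)$ tridiagonal matrix with rows and columns indexed by $0,1,\ldots,N$ and entries $$(\mathbf J_{N,\nu}(\alpha))_{k,k}=\alpha+2k(N-k)+\nu(N-k)+(2-\nu)k\quad(0\le k\le N),$$ $$(\mathbf J_{N,\nu}(\alpha))_{k,k+1}=(N-k)(k+\nu),\qquad(\mathbf J_{N,\nu}(\alpha))_{k+1,k}=(k+1)(N-k+1-\nu)\quad(0\le k\le N-1),$$ all other entries being zero. *)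

theory Defs
  imports Complex_Main "Jordan_Normal_Form.Determinant" "Jordan_Normal_Form.DL_Submatrix"
begin

text \<open>
  Minors are indexed by a set of rows and a set of columns of equal cardinality;
  \<^const>\<open>submatrix\<close> keeps the selected rows and columns in increasing order.
  The empty minor is the determinant of the 0 by 0 matrix, which is 1, so including it is harmless.
\<close>

definition totally_nonnegative :: "real mat \<Rightarrow> bool" where
  "totally_nonnegative A \<longleftrightarrow>
     (\<forall>I J. I \<subseteq> {..<dim_row A} \<and> J \<subseteq> {..<dim_col A} \<and> card I = card J
        \<longrightarrow> det (submatrix A I J) \<ge> 0)"

text \<open>All subtractions below are taken in the reals, so none of them truncates.\<close>

definition J_mat :: "nat \<Rightarrow> real \<Rightarrow> real \<Rightarrow> real mat" where
  "J_mat N \<nu> \<alpha> = mat (N + 1) (N + 1) (\<lambda>(i, j).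
     if j = i then
       \<alpha> + 2 * real i * (real N - real i) + \<nu> * (real N - real i) + (2 - \<nu>) * real i
     else if j = i + 1 then (real N - real i) * (real i + \<nu>)
     else if i = j + 1 then (real j + 1) * (real N - real j + 1 - \<nu>)
     else 0)"

definition K_mat :: "nat \<Rightarrow> real \<Rightarrow> real \<Rightarrow> real \<Rightarrow> real mat" where
  "K_mat N \<nu> a b =
     J_mat N \<nu> (1 / 4 - a\<^sup>2 + b\<^sup>2) ^\<^sub>m 2 + (4 * a\<^sup>2 * b\<^sup>2) \<cdot>\<^sub>m 1\<^sub>m (N + 1)"

end

theory Submission
  imports Defs
begin

text \<open>
  Put \<open>z = a + i b\<close>, so that \<open>K = (J(1/4) - z\<^sup>2) (J(1/4) - w\<^sup>2)\<close> with \<open>w\<close> the conjugate of \<open>z\<close>, and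
  let \<open>y m\<close> be the quotient by \<open>-2ab\<close> of the imaginary part of the leading \<open>m\<close> by \<open>m\<close> minor of
  \<open>J(1/4) - z\<^sup>2\<close>. Then \<open>K\<close> is a positive diagonal matrix multiplied on either side by
  two bidiagonal matrices whose off-diagonal entries are nonnegative as soon as all \<open>y m\<close> are positive;
  conversely the minor of \<open>K\<close> without the first row and the last column is a positive multiple of
  \<open>y (N + 1)\<close>.

  The operator \<open>J(1/4)\<close> is of Hahn type, with eigenvalues \<open>(j + 1/2)\<^sup>2\<close>. Hence \<open>y m\<close> is a positive
  combination of the imaginary parts of the products of \<open>(i + 1/2)\<^sup>2 - z\<^sup>2\<close> over \<open>i < j\<close>, \<open>j \<le> m\<close>, and
  for \<open>m = N + 1\<close> only \<open>j = N + 1\<close> occurs. The argument of such a product is a sum of differences of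
  arctangents, monotone in \<open>a\<close>; for \<open>a = 1\<close> it telescopes and tends to \<open>pi\<close> in absolute value without
  reaching it. So no sign change occurs for \<open>a \<le> 1\<close>, whereas for \<open>a > 1\<close> the first one gives a negative
  minor.
\<close>

section \<open>Total nonnegativity under bidiagonal multiplication\<close>

lemma det_mat_fun:
  "det (mat n n (\<lambda>(i, j). F i j)) =
     (\<Sum>p | p permutes {0..<n}. signof p * (\<Prod>i = 0..<n. F i (p i)))"
proof -
  have "(\<Prod>i = 0..<n. mat n n (\<lambda>(i, j). F i j) $$ (i, p i)) = (\<Prod>i = 0..<n. F i (p i))"
    if "p permutes {0..<n}" for p
    using that by (intro prod.cong) (auto dest: permutes_in_image)
  then show ?thesis
    by (subst det_def'[of _ n]) (auto intro!: sum.cong)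
qed

lemma det_row_linear:
  fixes X Y :: "nat \<Rightarrow> 'a :: comm_ring_1"
  assumes "k < n"
  shows "det (mat n n (\<lambda>(i, j). if i = k then X j + q * Y j else C i j)) =
         det (mat n n (\<lambda>(i, j). if i = k then X j else C i j)) +
         q * det (mat n n (\<lambda>(i, j). if i = k then Y j else C i j))"
proof -
  have *: "(\<Prod>i = 0..<n. if i = k then Z (p i) else C i (p i)) =
           Z (p k) * (\<Prod>i \<in> {0..<n} - {k}. C i (p i))" for Z :: "nat \<Rightarrow> 'a" and p
    using assms by (subst prod.remove[of _ k]) auto
  show ?thesis
    unfolding det_mat_fun *[of X] *[of Y] *[of "\<lambda>j. X j + q * Y j"]
    by (simp add: algebra_simps sum.distrib sum_distrib_left)
qed

text \<open>Increasing index maps replace index sets because \<open>tnn_add_prev_row\<close> changes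
  the rows of a minor one at a time, and the repeated rows that arise cannot be recorded by a
  set.\<close>

definition tnn :: "nat \<Rightarrow> (nat \<Rightarrow> nat \<Rightarrow> real) \<Rightarrow> bool" where
  "tnn n A \<longleftrightarrow> (\<forall>m f g. f ` {..<m} \<subseteq> {..<n} \<and> g ` {..<m} \<subseteq> {..<n}
      \<and> strict_mono_on {..<m} f \<and> strict_mono_on {..<m} g
      \<longrightarrow> 0 \<le> det (mat m m (\<lambda>(i, j). A (f i) (g j))))"

lemma tnn_cong:
  assumes "tnn n A" "\<And>i j. i < n \<Longrightarrow> j < n \<Longrightarrow> A i j = B i j"
  shows "tnn n B"
  unfolding tnn_def
proof (intro allI impI, elim conjE)
  fix m and f g :: "nat \<Rightarrow> nat"
  assume *: "f ` {..<m} \<subseteq> {..<n}" "g ` {..<m} \<subseteq> {..<n}"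
    "strict_mono_on {..<m} f" "strict_mono_on {..<m} g"
  then have "0 \<le> det (mat m m (\<lambda>(i, j). A (f i) (g j)))" using assms(1) unfolding tnn_def by blast
  also have "mat m m (\<lambda>(i, j). A (f i) (g j)) = mat m m (\<lambda>(i, j). B (f i) (g j))"
    using * assms(2) by (intro eq_matI) (auto simp: image_subset_iff)
  finally show "0 \<le> det (mat m m (\<lambda>(i, j). B (f i) (g j)))" .
qed

text \<open>\<open>pick\<close> enumerates a set in increasing order, so every minor in the sense of
  \<open>totally_nonnegative\<close> comes from two increasing maps.\<close>

lemma tnn_imp_totally_nonnegative:
  assumes "tnn n A" "K \<in> carrier_mat n n" "\<And>i j. i < n \<Longrightarrow> j < n \<Longrightarrow> K $$ (i, j) = A i j"
  shows "totally_nonnegative K"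
  unfolding totally_nonnegative_def
proof (intro allI impI, elim conjE)
  fix I J :: "nat set"
  assume "I \<subseteq> {..<dim_row K}" "J \<subseteq> {..<dim_col K}" and c: "card I = card J"
  then have I: "I \<subseteq> {..<n}" and J: "J \<subseteq> {..<n}" using assms(2) by auto
  have cI: "{i. i < n \<and> i \<in> I} = I" "{i. i < n \<and> i \<in> J} = J" using I J by auto
  have pick: "pick S ` {..<card S} \<subseteq> S" "strict_mono_on {..<card S} (pick S)" for S :: "nat set"
    by (auto intro!: pick_in_set pick_mono strict_mono_onI)
  have b: "pick I i < n" "pick J i < n" if "i < card J" for i
    using that pick(1)[of I] pick(1)[of J] c I J by auto
  have "submatrix K I J = mat (card J) (card J) (\<lambda>(i, j). A (pick I i) (pick J j))"
    unfolding submatrix_def using assms(2,3) cI c b by (intro eq_matI) auto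
  moreover have "0 \<le> det (mat (card J) (card J) (\<lambda>(i, j). A (pick I i) (pick J j)))"
    using assms(1)[unfolded tnn_def, rule_format, of "pick I" "card J" "pick J"]
      pick[of I] pick[of J] c I J by auto
  ultimately show "0 \<le> det (submatrix K I J)" by simp
qed

lemma tnn_transpose:
  assumes "tnn n A" shows "tnn n (\<lambda>i j. A j i)"
  unfolding tnn_def
proof (intro allI impI, elim conjE)
  fix m and f g :: "nat \<Rightarrow> nat"
  assume *: "f ` {..<m} \<subseteq> {..<n}" "g ` {..<m} \<subseteq> {..<n}"
    "strict_mono_on {..<m} f" "strict_mono_on {..<m} g"
  have "0 \<le> det (mat m m (\<lambda>(i, j). A (g i) (f j)))" using assms * unfolding tnn_def by blast
  also have "\<dots> = det (transpose_mat (mat m m (\<lambda>(i, j). A (g i) (f j))))"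
    by (rule det_transpose[symmetric, of _ m]) simp
  also have "transpose_mat (mat m m (\<lambda>(i, j). A (g i) (f j))) = mat m m (\<lambda>(i, j). A (g j) (f i))"
    by (intro eq_matI) auto
  finally show "0 \<le> det (mat m m (\<lambda>(i, j). A (g j) (f i)))" .
qed

text \<open>If the two index sets agree, the minor is itself diagonal; otherwise one of its rows is
  zero.\<close>

lemma tnn_diagonal:
  assumes "\<And>i. i < n \<Longrightarrow> 0 \<le> D i"
  shows "tnn n (\<lambda>i j. if i = j then D i else 0)"
  unfolding tnn_def
proof (intro allI impI, elim conjE)
  fix m f g
  assume fn: "f ` {..<m} \<subseteq> {..<n}" and gn: "g ` {..<m} \<subseteq> {..<n}"
    and f: "strict_mono_on {..<m} f" and g: "strict_mono_on {..<m} (g :: nat \<Rightarrow> nat)"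
  let ?A = "mat m m (\<lambda>(i, j). if f i = g j then D (f i) else 0)"
  have sd: "sorted (map h [0..<m])" "distinct (map h [0..<m])"
    if "strict_mono_on {..<m} h" for h :: "nat \<Rightarrow> nat"
  proof -
    show "sorted (map h [0..<m])"
      using that by (auto simp: sorted_iff_nth_mono_less strict_mono_on_def intro: less_imp_le)
    show "distinct (map h [0..<m])"
      using that by (auto simp: distinct_map atLeast0LessThan strict_mono_on_imp_inj_on)
  qed
  show "0 \<le> det ?A"
  proof (cases "f ` {..<m} = g ` {..<m}")
    case True
    then have "map f [0..<m] = map g [0..<m]"
      using sd[OF f] sd[OF g] by (intro sorted_distinct_set_unique) (auto simp: atLeast0LessThan)
    then have fg: "f i = g i" if "i < m" for i using that by (auto simp: list_eq_iff_nth_eq)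
    have "i = j" if "i < m" "j < m" "f i = g j" for i j
      using that fg g by (metis inj_onD lessThan_iff strict_mono_on_imp_inj_on)
    then have E: "?A = mat m m (\<lambda>(i, j). if i = j then D (f i) else 0)"
      using fg by (intro eq_matI) auto
    have "det ?A = prod_list (diag_mat (mat m m (\<lambda>(i, j). if i = j then D (f i) else 0)))"
      unfolding E by (rule det_upper_triangular[of _ m]) auto
    moreover have "0 \<le> D (f i)" if "i < m" for i using assms fn that by auto
    ultimately show ?thesis by (auto simp: diag_mat_def intro!: prod_list_nonneg)
  next
    case False
    \<comment> \<open>Both images have \<open>m\<close> elements, so an inclusion would already be
      an equality.\<close>
    have "f ` {..<m} \<noteq> g ` {..<m} \<Longrightarrow> \<exists>i<m. f i \<notin> g ` {..<m}"
      using card_subset_eq[of "g ` {..<m}" "f ` {..<m}"]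
        card_image[OF strict_mono_on_imp_inj_on[OF f]] card_image[OF strict_mono_on_imp_inj_on[OF g]]
      by auto
    then obtain i where i: "i < m" "f i \<notin> g ` {..<m}" using False by blast
    have "(\<Prod>k = 0..<m. if f k = g (p k) then D (f k) else 0) = 0" if "p permutes {0..<m}" for p
      using i permutes_in_image[OF that, of i] by (intro prod_zero) (auto intro!: bexI[of _ i])
    then have "det ?A = 0" unfolding det_mat_fun by (intro sum.neutral) simp
    then show ?thesis by simp
  qed
qed

text \<open>Expanding a minor row by row yields minors of \<open>A\<close> whose rows are weakly increasing;
  those with a repeated row vanish.\<close>

lemma tnn_add_prev_row:
  assumes A: "tnn n A" and q: "\<And>i. i < n \<Longrightarrow> 0 \<le> q i"
  shows "tnn n (\<lambda>i j. A i j + q i * A (i - 1) j)"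
  unfolding tnn_def
proof (intro allI impI, elim conjE)
  fix m f g
  assume fn: "f ` {..<m} \<subseteq> {..<n}" and gn: "g ` {..<m} \<subseteq> {..<n}"
    and f: "strict_mono_on {..<m} f" and g: "strict_mono_on {..<m} (g :: nat \<Rightarrow> nat)"
  let ?B = "\<lambda>i j. A i j + q i * A (i - 1) j"
  \<comment> \<open>The first \<open>t\<close> rows are still sums; \<open>h\<close> records which
    summand has been chosen in each later row.\<close>
  have "0 \<le> det (mat m m (\<lambda>(i, j). if i < t then ?B (f i) (g j) else A (h i) (g j)))"
    if "t \<le> m" "\<And>i. i < m \<Longrightarrow> h i = f i \<or> h i = f i - 1" for t h
    using that
  proof (induction t arbitrary: h)
    case 0
    have hn: "h ` {..<m} \<subseteq> {..<n}" using fn 0(2) by fastforce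
    \<comment> \<open>A choice lowers an index by at most 1, hence
      \<open>h i \<le> f i \<le> f j - 1 \<le> h j\<close>.\<close>
    have le: "h i \<le> h j" if "i < j" "j < m" for i j
    proof -
      have "f i < f j" using f that by (auto simp: strict_mono_on_def)
      then show ?thesis using 0(2)[of i] 0(2)[of j] that by auto
    qed
    show ?case
    proof (cases "strict_mono_on {..<m} h")
      case True
      then show ?thesis using A hn gn g unfolding tnn_def by simp
    next
      case False
      then obtain i j where ij: "i < j" "j < m" "\<not> h i < h j"
        by (auto simp: strict_mono_on_def)
      with le[of i j] have "h i = h j" by simp
      with ij have "det (mat m m (\<lambda>(i, j). A (h i) (g j))) = 0"
        by (intro det_identical_rows[of _ m i j]) auto
      then show ?thesis by simp
    qed
  next
    case (Suc t)
    let ?M = "\<lambda>h. mat m m (\<lambda>(i, j). if i < t then ?B (f i) (g j) else A (h i) (g j))"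
    let ?C = "\<lambda>i j. if i < t then ?B (f i) (g j) else A (h i) (g j)"
    have t: "t < m" using Suc by simp
    have "mat m m (\<lambda>(i, j). if i < Suc t then ?B (f i) (g j) else A (h i) (g j)) =
        mat m m (\<lambda>(i, j). if i = t then A (f t) (g j) + q (f t) * A (f t - 1) (g j) else ?C i j)"
      by (intro eq_matI) (auto simp: less_Suc_eq)
    moreover have "mat m m (\<lambda>(i, j). if i = t then A (f t) (g j) else ?C i j) = ?M (h(t := f t))"
      "mat m m (\<lambda>(i, j). if i = t then A (f t - 1) (g j) else ?C i j) = ?M (h(t := f t - 1))"
      by (auto intro!: eq_matI)
    ultimately have "det (mat m m (\<lambda>(i, j). if i < Suc t then ?B (f i) (g j) else A (h i) (g j))) =
        det (?M (h(t := f t))) + q (f t) * det (?M (h(t := f t - 1)))"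
      using det_row_linear[OF t, of "\<lambda>j. A (f t) (g j)" "q (f t)" "\<lambda>j. A (f t - 1) (g j)" ?C]
      by simp
    moreover have "0 \<le> det (?M (h(t := f t)))" "0 \<le> det (?M (h(t := f t - 1)))"
      using t Suc.prems(2) by (intro Suc.IH; simp; metis)+
    moreover have "0 \<le> q (f t)" using q fn t by auto
    ultimately show ?case by simp
  qed
  from this[of m f] have "0 \<le> det (mat m m (\<lambda>(i, j). if i < m then ?B (f i) (g j) else A (f i) (g j)))"
    by simp
  also have "mat m m (\<lambda>(i, j). if i < m then ?B (f i) (g j) else A (f i) (g j)) =
      mat m m (\<lambda>(i, j). ?B (f i) (g j))" by (intro eq_matI) auto
  finally show "0 \<le> det (mat m m (\<lambda>(i, j). ?B (f i) (g j)))" .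
qed

lemma tnn_add_prev_col:
  assumes "tnn n A" "\<And>j. j < n \<Longrightarrow> 0 \<le> q j"
  shows "tnn n (\<lambda>i j. A i j + q j * A i (j - 1))"
  using tnn_transpose[OF tnn_add_prev_row[OF tnn_transpose[OF assms(1)], of q]] assms(2) by simp

text \<open>This is left multiplication by the unit lower bidiagonal matrix \<open>E\<close>. As
  \<open>0 - 1 = 0\<close>, the condition on \<open>q 0\<close> keeps row 0 from being added to
  itself.\<close>

lemma det_add_prev_row:
  fixes A :: "nat \<Rightarrow> nat \<Rightarrow> 'a :: comm_ring_1"
  assumes "q 0 = 0"
  shows "det (mat n n (\<lambda>(i, j). A i j + q i * A (i - 1) j)) = det (mat n n (\<lambda>(i, j). A i j))"
proof -
  define E where "E = mat n n (\<lambda>(i, j). if i = j then 1 else if i = j + 1 then q i else 0)"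
  have "(\<Sum>k = 0..<n. E $$ (i, k) * A k j) = A i j + q i * A (i - 1) j" if "i < n" for i j
  proof -
    have "(\<Sum>k = 0..<n. E $$ (i, k) * A k j) =
        (\<Sum>k = 0..<n. (if k = i then A i j else 0) + (if k = i - 1 then q i * A (i - 1) j else 0))"
      using that assms by (cases i) (auto simp: E_def intro!: sum.cong)
    then show ?thesis using that by (simp add: sum.distrib less_imp_diff_less)
  qed
  then have "mat n n (\<lambda>(i, j). A i j + q i * A (i - 1) j) = E * mat n n (\<lambda>(i, j). A i j)"
    by (intro eq_matI) (auto simp: E_def scalar_prod_def)
  moreover have "det E = 1"
    by (subst det_lower_triangular[of n]) (auto simp: E_def prod_list_diag_prod)
  moreover have "det (E * mat n n (\<lambda>(i, j). A i j)) = det E * det (mat n n (\<lambda>(i, j). A i j))"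
    by (rule det_mult) (auto simp: E_def)
  ultimately show ?thesis by simp
qed

lemma det_add_prev_col:
  fixes A :: "nat \<Rightarrow> nat \<Rightarrow> 'a :: comm_ring_1"
  assumes "q 0 = 0"
  shows "det (mat n n (\<lambda>(i, j). A i j + q j * A i (j - 1))) = det (mat n n (\<lambda>(i, j). A i j))"
proof -
  have T: "det (mat n n (\<lambda>(i, j). F i j)) = det (mat n n (\<lambda>(i, j). F j i))"
    for F :: "nat \<Rightarrow> nat \<Rightarrow> 'a"
  proof -
    have "mat n n (\<lambda>(i, j). F j i) = transpose_mat (mat n n (\<lambda>(i, j). F i j))"
      by (intro eq_matI) auto
    then show ?thesis by (simp add: det_transpose[of _ n])
  qed
  show ?thesis
    using det_add_prev_row[of q, OF assms, where A = "\<lambda>i j. A j i" and n = n]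
      T[of "\<lambda>i j. A i j + q j * A i (j - 1)"] T[of A] by simp
qed

lemma invertible_mat_of_det:
  fixes A :: "'a :: field mat"
  assumes A: "A \<in> carrier_mat n n" and "det A \<noteq> 0"
  shows "invertible_mat A"
proof -
  have "inverts_mat A (inverse (det A) \<cdot>\<^sub>m adj_mat A)" "inverts_mat (inverse (det A) \<cdot>\<^sub>m adj_mat A) A"
    using adj_mat[OF A] assms
    by (auto simp: inverts_mat_def mult_smult_distrib[OF A] mult_smult_assoc_mat[of _ n n _ n])
  then show ?thesis using A by (auto simp: invertible_mat_def)
qed

section \<open>The square of a tridiagonal matrix plus a scalar\<close>

text \<open>
  \<open>T\<close> has the entry \<open>d k\<close> at \<open>(k, k - 1)\<close> and \<open>u k\<close> at \<open>(k - 1, k)\<close>, and \<open>x m - i \<mu> y m\<close> is the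
  leading \<open>m\<close> by \<open>m\<close> minor of \<open>T - i \<mu>\<close>; working with \<open>y\<close> instead of the imaginary part keeps the
  case \<open>\<mu> = 0\<close> meaningful.
\<close>

locale tridiagonal_square =
  fixes a u d x y :: "nat \<Rightarrow> real" and \<mu> :: real and N :: nat
  assumes u_0: "u 0 = 0" and d_0: "d 0 = 0"
    and x_0: "x 0 = 1" and y_0: "y 0 = 0"
    and x_Suc: "x (Suc m) = a m * x m - \<mu>\<^sup>2 * y m - u m * d m * x (m - 1)"
    and y_Suc: "y (Suc m) = a m * y m + x m - u m * d m * y (m - 1)"
    and y_neq_0: "1 \<le> m \<Longrightarrow> m \<le> N \<Longrightarrow> y m \<noteq> 0"
    and u_pos: "1 \<le> m \<Longrightarrow> m \<le> N \<Longrightarrow> 0 < u m"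
    and d_pos: "1 \<le> m \<Longrightarrow> m \<le> N \<Longrightarrow> 0 < d m"
begin

text \<open>The recurrences contain \<open>u\<close> and \<open>d\<close> only through their
  product, so transposing \<open>T\<close> gives another instance.\<close>

lemma swap_tridiagonal_square: "tridiagonal_square a d u x y \<mu> N"
  using u_0 d_0 x_0 y_0 y_neq_0 u_pos d_pos x_Suc y_Suc
  by unfold_locales (auto simp: mult.commute)

definition T :: "nat \<Rightarrow> nat \<Rightarrow> real" where
  "T i j = (if i = j then a i else if i = j + 1 then d i else if j = i + 1 then u j else 0)"

text \<open>Row \<open>i\<close> of \<open>T\<^sup>2 + \<mu>\<^sup>2\<close> for the infinite matrix
  \<open>T\<close>. At \<open>i = 0\<close>, where \<open>i - 1\<close> truncates, the factor
  \<open>d 0 = 0\<close> removes the first term.\<close>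

definition K :: "nat \<Rightarrow> nat \<Rightarrow> real" where
  "K i j = d i * T (i - 1) j + a i * T i j + u (i + 1) * T (i + 1) j + (if i = j then \<mu>\<^sup>2 else 0)"

text \<open>By the Christoffel-Darboux formula \<open>W m\<close> is the leading \<open>m\<close> by \<open>m\<close> minor of \<open>K\<close>.\<close>

definition W :: "nat \<Rightarrow> real" where
  "W m = x m * y (Suc m) - x (Suc m) * y m"

text \<open>When the recurrences for \<open>x\<close> and \<open>y\<close> are inserted into
  \<open>W\<close>, the terms with \<open>a\<close> cancel.\<close>

lemma W_Suc: "W (Suc m) = (x (Suc m))\<^sup>2 + \<mu>\<^sup>2 * (y (Suc m))\<^sup>2 + u (Suc m) * d (Suc m) * W m"
  unfolding W_def x_Suc[of "Suc m"] y_Suc[of "Suc m"]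
  by (simp add: algebra_simps power2_eq_square)

lemma y_1: "y (Suc 0) = 1" and x_1: "x (Suc 0) = a 0"
  using x_Suc[of 0] y_Suc[of 0] by (auto simp: x_0 y_0 u_0)

lemma W_0: "W 0 = 1"
  by (simp add: W_def x_0 y_0 y_1)

lemma W_pos: "m \<le> N \<Longrightarrow> 0 < W m"
proof (induction m)
  case 0
  then show ?case by (simp add: W_0)
next
  case (Suc m)
  then have "0 < u (Suc m) * d (Suc m) * W m"
    using u_pos[of "Suc m"] d_pos[of "Suc m"] by simp
  moreover have "0 \<le> (x (Suc m))\<^sup>2 + \<mu>\<^sup>2 * (y (Suc m))\<^sup>2" by simp
  ultimately show ?case unfolding W_Suc by linarith
qed

text \<open>\<open>M\<close> is what remains of \<open>K\<close> after splitting off the outer pair of bidiagonal factors given by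
  \<open>row_coeff\<close> and \<open>col_coeff\<close>; the primed pair then reduces \<open>M\<close> to the diagonal matrix \<open>D\<close>.\<close>

definition M :: "nat \<Rightarrow> nat \<Rightarrow> real" where
  "M i j = (if i = j then
       if i = 0 then W 1
       else u (i + 1) * d (i + 1) + ((y (i + 1))\<^sup>2 - x (i + 1) * y i - x i * y (i + 1)) / (y i)\<^sup>2
     else if i = j + 1 then d i * y (i + 1) / y i
     else if j = i + 1 then u j * y (j + 1) / y j
     else 0)"

definition row_coeff :: "nat \<Rightarrow> real" where "row_coeff i = d i * y (i - 1) / y i"
definition col_coeff :: "nat \<Rightarrow> real" where "col_coeff j = u j * y (j - 1) / y j"

definition row_coeff' :: "nat \<Rightarrow> real" where
  "row_coeff' i = d i * y (i + 1) * W (i - 1) / (W i * y i)"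
definition col_coeff' :: "nat \<Rightarrow> real" where
  "col_coeff' j = u j * y (j + 1) * W (j - 1) / (W j * y j)"

text \<open>The pivots of \<open>K\<close>: quotients of successive leading minors.\<close>

definition D :: "nat \<Rightarrow> nat \<Rightarrow> real" where
  "D i j = (if i = j then W (Suc i) / W i else 0)"

lemmas coeff_defs = row_coeff_def col_coeff_def row_coeff'_def col_coeff'_def

section \<open>Verification of the two factorizations, entry by entry\<close>

lemma coeff_0 [simp]: "row_coeff 0 = 0" "col_coeff 0 = 0" "row_coeff' 0 = 0" "col_coeff' 0 = 0"
  "row_coeff (Suc 0) = 0" "col_coeff (Suc 0) = 0"
  by (simp_all add: coeff_defs u_0 d_0 y_0)

text \<open>The entry of \<open>K\<close> at \<open>(i, i)\<close> for \<open>i \<ge> 2\<close>,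
  after cancelling \<open>u (i + 1) * d (i + 1)\<close>: \<open>Y0\<close>, \<open>Y1\<close>,
  \<open>Y2\<close> stand for \<open>y (i - 1)\<close>, \<open>y i\<close>,
  \<open>y (i + 1)\<close>, \<open>p\<close> for \<open>a i\<close> and \<open>w\<close> for
  \<open>u i * d i\<close>. The summand with the factor 2 unites the row and the column
  contribution.\<close>

lemma diag_factor:
  fixes X0 X1 Y0 Y1 p w :: real
  assumes "Y0 \<noteq> 0" "Y1 \<noteq> 0"
    and "Y2 = p * Y1 + X1 - w * Y0" "X2 = p * X1 - \<mu>\<^sup>2 * Y1 - w * X0"
  shows "w + p\<^sup>2 + \<mu>\<^sup>2 = (Y2\<^sup>2 - X2 * Y1 - X1 * Y2) / Y1\<^sup>2 + 2 * w * Y0 * Y2 / Y1\<^sup>2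
           + w * Y0\<^sup>2 / Y1\<^sup>2 * (w + (Y1\<^sup>2 - X1 * Y0 - X0 * Y1) / Y0\<^sup>2)"
  using assms(1,2) unfolding assms(3,4) by (simp add: field_simps power2_eq_square)

text \<open>The entry of \<open>K\<close> at \<open>(i, i - 1)\<close> for \<open>i \<ge> 2\<close>,
  divided by \<open>d i\<close>; here \<open>Y\<close> is \<open>y (i - 2)\<close> and
  \<open>Y2\<close> is \<open>y (i + 1)\<close>.\<close>

lemma subdiag_factor:
  fixes X0 X1 Y Y0 Y1 p0 p1 w0 w1 :: real
  assumes "Y0 \<noteq> 0" "Y1 \<noteq> 0"
    and Y1: "Y1 = p0 * Y0 + X0 - w0 * Y" and Y2: "Y2 = p1 * Y1 + X1 - w1 * Y0"
  shows "p0 + p1 = Y2 / Y1 + Y0 / Y1 * (w1 + (Y1\<^sup>2 - X1 * Y0 - X0 * Y1) / Y0\<^sup>2) + w0 * Y / Y0"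
proof -
  have X0: "X0 = Y1 - p0 * Y0 + w0 * Y" using Y1 by simp
  show ?thesis
    using assms(1,2) unfolding Y2 X0 by (simp add: field_simps power2_eq_square)
qed

text \<open>From the third subdiagonal on both sides vanish. On the diagonal and the first
  subdiagonal the entries with small indices are treated apart, since \<open>y 0 = 0\<close>
  excludes the general identities there.\<close>

lemma K_eq_lower:
  assumes "i \<le> N" "j \<le> i"
  shows "K i j = (M i j + row_coeff i * M (i - 1) j)
       + col_coeff j * (M i (j - 1) + row_coeff i * M (i - 1) (j - 1))"
proof -
  consider "i = 0" "j = 0" | "i = 1" "j = 1" | k where "i = Suc (Suc k)" "j = Suc (Suc k)"
    | "i = 1" "j = 0" | k where "i = Suc (Suc k)" "j = Suc k"
    | "i = Suc (Suc j)" | "Suc (Suc (Suc j)) \<le> i"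
  proof -
    consider "i = j" | "i = Suc j" | "i = Suc (Suc j)" | "Suc (Suc (Suc j)) \<le> i"
      using assms(2) by linarith
    moreover have "j = 0 \<or> j = 1 \<or> (\<exists>k. j = Suc (Suc k))" "j = 0 \<or> (\<exists>k. j = Suc k)"
      by presburger+
    ultimately show ?thesis
      using that by cases (metis One_nat_def)+
  qed
  then show ?thesis
  proof cases
    case 1
    then show ?thesis
      using W_Suc[of 0]
      by (simp add: K_def M_def T_def d_0 W_0 x_1 y_1 power2_eq_square)
  next
    case 2
    then show ?thesis
      using x_Suc[of 1] y_Suc[of 1]
      by (simp add: K_def M_def T_def x_1 y_1 x_0 y_0 power2_eq_square algebra_simps)
  next
    case (3 k)
    have ne: "y (Suc k) \<noteq> 0" "y (Suc (Suc k)) \<noteq> 0"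
      using y_neq_0[of "Suc k"] y_neq_0[of "Suc (Suc k)"] assms 3 by auto
    show ?thesis
      using diag_factor[OF ne y_Suc[of "Suc (Suc k)", simplified] x_Suc[of "Suc (Suc k)", simplified]] ne 3
      by (simp add: K_def M_def T_def coeff_defs power2_eq_square mult_ac add_divide_distrib diff_divide_distrib ring_distribs)
  next
    case 4
    then show ?thesis
      using y_Suc[of 1] by (simp add: K_def M_def T_def x_1 y_1 y_0 algebra_simps)
  next
    case (5 k)
    have ne: "y (Suc k) \<noteq> 0" "y (Suc (Suc k)) \<noteq> 0"
      using y_neq_0[of "Suc k"] y_neq_0[of "Suc (Suc k)"] assms 5 by auto
    have "K i j = d i * (a (Suc k) + a (Suc (Suc k)))"
      using 5 by (simp add: K_def T_def algebra_simps)
    also have "\<dots> = M i j + row_coeff i * M (i - 1) j + col_coeff j * (row_coeff i * M (i - 1) (j - 1))"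
      unfolding subdiag_factor[OF ne y_Suc[of "Suc k", simplified] y_Suc[of "Suc (Suc k)", simplified]]
      using ne 5
      by (simp add: M_def coeff_defs mult_ac ring_distribs)
    also have "\<dots> = (M i j + row_coeff i * M (i - 1) j)
       + col_coeff j * (M i (j - 1) + row_coeff i * M (i - 1) (j - 1))"
      using 5 by (cases k) (simp_all add: M_def)
    finally show ?thesis .
  next
    case 6
    then have "y i \<noteq> 0" "y (Suc j) \<noteq> 0"
      using y_neq_0[of i] y_neq_0[of "Suc j"] assms by auto
    moreover have "M i (j - 1) = 0" "j = 0 \<or> M (i - 1) (j - 1) = 0" using 6 by (auto simp: M_def)
    ultimately show ?thesis using 6 by (auto simp: K_def T_def M_def row_coeff_def)
  next
    case 7
    then show ?thesis by (auto simp: K_def T_def M_def)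
  qed
qed

lemma M_eq_lower:
  assumes "i \<le> N" "j \<le> i"
  shows "M i j = (D i j + row_coeff' i * D (i - 1) j)
       + col_coeff' j * (D i (j - 1) + row_coeff' i * D (i - 1) (j - 1))"
proof -
  consider "i = 0" "j = 0" | k where "i = Suc k" "j = Suc k" | "i = Suc j" | "Suc (Suc j) \<le> i"
  proof -
    consider "i = j" | "i = Suc j" | "Suc (Suc j) \<le> i"
      using assms(2) by linarith
    moreover have "j = 0 \<or> (\<exists>k. j = Suc k)" by presburger
    ultimately show ?thesis
      using that by cases metis+
  qed
  then show ?thesis
  proof cases
    case 1
    then show ?thesis by (simp add: M_def D_def W_def x_0 y_0 y_1)
  next
    case (2 k)
    have W: "W k > 0" "W (Suc k) > 0" and y: "y (Suc k) \<noteq> 0"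
      using W_pos[of k] W_pos[of "Suc k"] y_neq_0[of "Suc k"] assms 2 by auto
    let ?X = "x (Suc k)" let ?Y = "y (Suc k)" let ?X2 = "x (Suc (Suc k))" let ?Y2 = "y (Suc (Suc k))"
    have *: "u (Suc k) * d (Suc k) * W k = W (Suc k) - ?X\<^sup>2 - \<mu>\<^sup>2 * ?Y\<^sup>2"
      using W_Suc[of k] by simp
    \<comment> \<open>After both substitutions the terms with \<open>\<mu>\<close> cancel, and the
      remaining \<open>?X2\<^sup>2 * ?Y\<^sup>2 - ?X\<^sup>2 * ?Y2\<^sup>2\<close> is a difference
      of squares with the factor \<open>W (Suc k)\<close>.\<close>
    have "W (Suc (Suc k)) * ?Y\<^sup>2 + ?Y2\<^sup>2 * (u (Suc k) * d (Suc k) * W k) =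
       W (Suc k) * (u (Suc (Suc k)) * d (Suc (Suc k)) * ?Y\<^sup>2 + (?Y2\<^sup>2 - ?X2 * ?Y - ?X * ?Y2))"
      unfolding * W_Suc[of "Suc k"] by (simp add: W_def algebra_simps power2_eq_square)
    moreover have "M i j = u (Suc (Suc k)) * d (Suc (Suc k)) + (?Y2\<^sup>2 - ?X2 * ?Y - ?X * ?Y2) / ?Y\<^sup>2"
      using 2 by (simp add: M_def)
    then have "M i j = W (Suc k) * (u (Suc (Suc k)) * d (Suc (Suc k)) * ?Y\<^sup>2
        + (?Y2\<^sup>2 - ?X2 * ?Y - ?X * ?Y2)) / (W (Suc k) * ?Y\<^sup>2)"
      using W y by (simp add: add_divide_distrib)
    ultimately have "M i j = (W (Suc (Suc k)) * ?Y\<^sup>2 + ?Y2\<^sup>2 * (u (Suc k) * d (Suc k) * W k)) / (W (Suc k) * ?Y\<^sup>2)"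
      by simp
    also have "\<dots> = W (Suc (Suc k)) / W (Suc k) + row_coeff' i * col_coeff' j * (W (Suc k) / W k)"
      using 2 W y by (simp add: coeff_defs field_simps power2_eq_square)
    finally show ?thesis using 2 by (auto simp: D_def)
  next
    case 3
    then have "W j > 0" "W i > 0" "y i \<noteq> 0"
      using W_pos[of j] W_pos[of i] y_neq_0[of i] assms by auto
    then show ?thesis using 3 by (cases j) (auto simp: M_def D_def coeff_defs u_0)
  next
    case 4
    then show ?thesis by (auto simp: M_def D_def)
  qed
qed

section \<open>Entries above the diagonal, by transposition\<close>

interpretation swap: tridiagonal_square a d u x y \<mu> N
  by (rule swap_tridiagonal_square)

lemma swap_simps:
  "swap.T i j = T j i" "swap.K i j = K j i" "swap.M i j = M j i"
  "swap.row_coeff = col_coeff" "swap.col_coeff = row_coeff"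
  "swap.row_coeff' = col_coeff'" "swap.col_coeff' = row_coeff'"
proof -
  show T: "swap.T i j = T j i" for i j by (auto simp: swap.T_def T_def)
  show "swap.K i j = K j i"
    by (cases i; cases j) (auto simp: swap.K_def K_def T_def swap.T_def u_0 d_0)
  show "swap.M i j = M j i"
    unfolding swap.M_def M_def by (simp add: mult.commute)
  show "swap.row_coeff = col_coeff" "swap.col_coeff = row_coeff"
    "swap.row_coeff' = col_coeff'" "swap.col_coeff' = row_coeff'"
    unfolding fun_eq_iff swap.coeff_defs coeff_defs by simp_all
qed

lemma D_commute: "D i j = D j i"
  by (simp add: D_def)

lemma K_eq:
  assumes "i \<le> N" "j \<le> N"
  shows "K i j = (M i j + row_coeff i * M (i - 1) j)
       + col_coeff j * (M i (j - 1) + row_coeff i * M (i - 1) (j - 1))"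
proof (cases "j \<le> i")
  case True
  then show ?thesis using K_eq_lower assms by blast
next
  case False
  then show ?thesis using swap.K_eq_lower[of j i] assms
    unfolding swap_simps by (simp add: algebra_simps)
qed

lemma M_eq:
  assumes "i \<le> N" "j \<le> N"
  shows "M i j = (D i j + row_coeff' i * D (i - 1) j)
       + col_coeff' j * (D i (j - 1) + row_coeff' i * D (i - 1) (j - 1))"
proof (cases "j \<le> i")
  case True
  then show ?thesis using M_eq_lower assms by blast
next
  case False
  then show ?thesis using swap.M_eq_lower[of j i] assms
    unfolding swap_simps by (simp add: algebra_simps D_commute)
qed

section \<open>Total nonnegativity, determinant and corner minor\<close>

lemma tnn_K:
  assumes y_pos: "\<And>m. 1 \<le> m \<Longrightarrow> m \<le> N + 1 \<Longrightarrow> 0 < y m" and W_last: "0 < W (N + 1)"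
  shows "tnn (N + 1) K"
proof -
  have W: "0 < W m" if "m \<le> N + 1" for m using that W_pos[of m] W_last by (cases "m = N + 1") auto
  have y: "0 \<le> y m" if "m \<le> N + 1" for m using that y_pos[of m] y_0 by (cases m) auto
  have ud: "0 \<le> u m" "0 \<le> d m" if "m \<le> N" for m
    using that u_pos[of m] d_pos[of m] u_0 d_0 by (cases m; auto)+
  have coeff: "0 \<le> row_coeff m" "0 \<le> col_coeff m" "0 \<le> row_coeff' m" "0 \<le> col_coeff' m"
    if "m < N + 1" for m
    unfolding coeff_defs using that
    by (intro divide_nonneg_nonneg mult_nonneg_nonneg y ud W[THEN less_imp_le]; simp)+
  have "tnn (N + 1) D"
    unfolding D_def using W by (intro tnn_diagonal) (auto intro!: divide_nonneg_nonneg less_imp_le)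
  then have "tnn (N + 1) (\<lambda>i j. (D i j + row_coeff' i * D (i - 1) j)
       + col_coeff' j * (D i (j - 1) + row_coeff' i * D (i - 1) (j - 1)))"
    by (rule tnn_add_prev_col[OF tnn_add_prev_row[of "N + 1" D row_coeff'], where q = col_coeff']) (rule coeff, assumption)+
  then have "tnn (N + 1) M" by (rule tnn_cong) (simp add: M_eq)
  then have "tnn (N + 1) (\<lambda>i j. (M i j + row_coeff i * M (i - 1) j)
       + col_coeff j * (M i (j - 1) + row_coeff i * M (i - 1) (j - 1)))"
    by (rule tnn_add_prev_col[OF tnn_add_prev_row[of "N + 1" M row_coeff], where q = col_coeff]) (rule coeff, assumption)+
  then show ?thesis by (rule tnn_cong) (simp add: K_eq)
qed

text \<open>The bidiagonal factors have determinant 1, so the determinant is the product of the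
  pivots.\<close>

lemma det_K:
  assumes W_last: "0 < W (N + 1)"
  shows "0 < det (mat (N + 1) (N + 1) (\<lambda>(i, j). K i j))"
proof -
  have W: "0 < W m" if "m \<le> N + 1" for m using that W_pos[of m] W_last by (cases "m = N + 1") auto
  have "mat (N + 1) (N + 1) (\<lambda>(i, j). K i j) = mat (N + 1) (N + 1)
      (\<lambda>(i, j). (M i j + row_coeff i * M (i - 1) j)
        + col_coeff j * (M i (j - 1) + row_coeff i * M (i - 1) (j - 1)))"
    by (intro eq_matI) (auto simp: K_eq)
  then have "det (mat (N + 1) (N + 1) (\<lambda>(i, j). K i j)) = det (mat (N + 1) (N + 1) (\<lambda>(i, j). M i j))"
    by (simp only: det_add_prev_col[of col_coeff "N + 1" "\<lambda>i j. M i j + row_coeff i * M (i - 1) j", OF coeff_0(2)]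
        det_add_prev_row[of row_coeff "N + 1" M, OF coeff_0(1)])
  also have "mat (N + 1) (N + 1) (\<lambda>(i, j). M i j) = mat (N + 1) (N + 1)
      (\<lambda>(i, j). (D i j + row_coeff' i * D (i - 1) j)
        + col_coeff' j * (D i (j - 1) + row_coeff' i * D (i - 1) (j - 1)))"
    by (intro eq_matI) (auto simp: M_eq)
  also have "det \<dots> = det (mat (N + 1) (N + 1) (\<lambda>(i, j). D i j))"
    by (simp only: det_add_prev_col[of col_coeff' "N + 1" "\<lambda>i j. D i j + row_coeff' i * D (i - 1) j", OF coeff_0(4)]
        det_add_prev_row[of row_coeff' "N + 1" D, OF coeff_0(3)])
  also have "\<dots> = prod_list (diag_mat (mat (N + 1) (N + 1) (\<lambda>(i, j). D i j)))"
    by (rule det_upper_triangular[of _ "N + 1"]) (auto simp: D_def)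
  also have "\<dots> = (\<Prod>i = 0..<N + 1. W (Suc i) / W i)"
    by (simp add: prod_list_diag_prod D_def)
  finally have "det (mat (N + 1) (N + 1) (\<lambda>(i, j). K i j)) = (\<Prod>i = 0..<N + 1. W (Suc i) / W i)" .
  moreover have "0 < (\<Prod>i = 0..<N + 1. W (Suc i) / W i)"
    by (intro prod_pos) (auto intro!: divide_pos_pos W)
  ultimately show ?thesis by (simp only:)
qed

text \<open>Without its first row \<open>M\<close> becomes upper triangular, with the former
  subdiagonal on the diagonal. The row operations survive the deletion because
  \<open>row_coeff 1 = 0\<close>: row 1 never uses row 0.\<close>

lemma det_K_corner:
  "det (mat N N (\<lambda>(i, j). K (Suc i) j)) = (\<Prod>i = 0..<N. d (Suc i) * y (Suc (Suc i)) / y (Suc i))"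
proof -
  let ?S = "\<lambda>i j. M (Suc i) j"
  define q where "q i = row_coeff (Suc i)" for i
  have q0: "q 0 = 0" by (simp add: q_def)
  have row: "M (Suc i) j + row_coeff (Suc i) * M (Suc i - 1) j = ?S i j + q i * ?S (i - 1) j" for i j
    using q0 by (cases i) (auto simp: q_def)
  have "mat N N (\<lambda>(i, j). K (Suc i) j) = mat N N (\<lambda>(i, j). (?S i j + q i * ?S (i - 1) j)
        + col_coeff j * (?S i (j - 1) + q i * ?S (i - 1) (j - 1)))"
    unfolding row[symmetric] by (intro eq_matI) (auto simp: K_eq)
  then have "det (mat N N (\<lambda>(i, j). K (Suc i) j)) = det (mat N N (\<lambda>(i, j). ?S i j))"
    by (simp only: det_add_prev_col[of col_coeff N "\<lambda>i j. ?S i j + q i * ?S (i - 1) j", OF coeff_0(2)]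
        det_add_prev_row[of q N ?S, OF q0])
  also have "\<dots> = prod_list (diag_mat (mat N N (\<lambda>(i, j). ?S i j)))"
    by (rule det_upper_triangular[of _ N]) (auto simp: M_def)
  also have "\<dots> = (\<Prod>i = 0..<N. d (Suc i) * y (Suc (Suc i)) / y (Suc i))"
    by (simp add: prod_list_diag_prod M_def)
  finally show ?thesis .
qed

lemma det_K_corner_neg:
  assumes "1 \<le> N" "\<And>m. 1 \<le> m \<Longrightarrow> m \<le> N \<Longrightarrow> 0 < y m" "y (N + 1) < 0"
  shows "det (mat N N (\<lambda>(i, j). K (Suc i) j)) < 0"
proof -
  obtain n where N: "N = Suc n" using assms(1) by (cases N) auto
  have "0 < (\<Prod>i = 0..<n. d (Suc i) * y (Suc (Suc i)) / y (Suc i))"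
    using assms(2) d_pos N by (intro prod_pos) auto
  moreover have "d (Suc n) * y (Suc (Suc n)) / y (Suc n) < 0"
    using assms(2)[of "Suc n"] assms(3) d_pos[of "Suc n"] N by (auto simp: mult_pos_neg divide_neg_pos)
  moreover have "det (mat N N (\<lambda>(i, j). K (Suc i) j)) =
      (\<Prod>i = 0..<n. d (Suc i) * y (Suc (Suc i)) / y (Suc i)) * (d (Suc n) * y (Suc (Suc n)) / y (Suc n))"
    unfolding det_K_corner by (simp add: N)
  ultimately show ?thesis by (simp only: mult_pos_neg)
qed

end

section \<open>The arguments of the partial products\<close>

text \<open>\<open>cprod s \<mu> n = (X, Y)\<close> encodes the product of \<open>s j + i \<mu>\<close> over \<open>j < n\<close> as \<open>X + i \<mu> Y\<close>.\<close>

primrec cprod :: "(nat \<Rightarrow> real) \<Rightarrow> real \<Rightarrow> nat \<Rightarrow> real \<times> real" where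
  "cprod s \<mu> 0 = (1, 0)"
| "cprod s \<mu> (Suc j) = (s j * fst (cprod s \<mu> j) - \<mu>\<^sup>2 * snd (cprod s \<mu> j),
                       s j * snd (cprod s \<mu> j) + fst (cprod s \<mu> j))"

text \<open>The squared modulus is multiplicative, and no factor is zero.\<close>

lemma cprod_norm_pos:
  assumes "\<And>j. s j \<noteq> 0 \<or> \<mu> \<noteq> 0"
  shows "0 < (fst (cprod s \<mu> j))\<^sup>2 + \<mu>\<^sup>2 * (snd (cprod s \<mu> j))\<^sup>2"
proof (induction j)
  case (Suc j)
  have "(fst (cprod s \<mu> (Suc j)))\<^sup>2 + \<mu>\<^sup>2 * (snd (cprod s \<mu> (Suc j)))\<^sup>2 =
      ((s j)\<^sup>2 + \<mu>\<^sup>2) * ((fst (cprod s \<mu> j))\<^sup>2 + \<mu>\<^sup>2 * (snd (cprod s \<mu> j))\<^sup>2)"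
    by (simp add: algebra_simps power2_eq_square)
  moreover have "0 < (s j)\<^sup>2 + \<mu>\<^sup>2" using assms[of j] by (auto simp: sum_power2_gt_zero_iff)
  ultimately show ?case using Suc by simp
qed simp

text \<open>With \<open>t = j + 1/2\<close>, the number
  \<open>t\<^sup>2 - a\<^sup>2 + b\<^sup>2 + 2iab\<close> factors as
  \<open>(b + i(t + a)) (b - i(t - a))\<close>; for \<open>b > 0\<close> this is the sum of the
  arguments of the two factors.\<close>

definition phase :: "real \<Rightarrow> real \<Rightarrow> nat \<Rightarrow> real" where
  "phase a b j = arctan ((real j + 1 / 2 + a) / b) - arctan ((real j + 1 / 2 - a) / b)"

lemma arctan_diff_polar:
  fixes t a b :: real
  assumes "0 < b"
  obtains r where "0 < r"
    "t\<^sup>2 - a\<^sup>2 + b\<^sup>2 = r * cos (arctan ((t + a) / b) - arctan ((t - a) / b))"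
    "2 * a * b = r * sin (arctan ((t + a) / b) - arctan ((t - a) / b))"
proof -
  define u v where "u = (t + a) / b" and "v = (t - a) / b"
  define p q where "p = sqrt (1 + u\<^sup>2)" and "q = sqrt (1 + v\<^sup>2)"
  have pq: "0 < p" "0 < q" by (simp_all add: p_def q_def add_pos_nonneg)
  have "cos (arctan u - arctan v) = (1 + u * v) / (p * q)"
    by (simp add: cos_diff cos_arctan sin_arctan add_divide_distrib flip: p_def q_def)
  moreover have "sin (arctan u - arctan v) = (u - v) / (p * q)"
    by (simp add: sin_diff cos_arctan sin_arctan diff_divide_distrib flip: p_def q_def)
  moreover have "t\<^sup>2 - a\<^sup>2 + b\<^sup>2 = b\<^sup>2 * (1 + u * v)" "2 * a * b = b\<^sup>2 * (u - v)"
    using assms by (simp_all add: u_def v_def field_simps power2_eq_square)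
  \<comment> \<open>\<open>b * p\<close> and \<open>b * q\<close> are the moduli of
    \<open>b + i(t + a)\<close> and \<open>b - i(t - a)\<close>.\<close>
  ultimately show ?thesis
    using that[of "b\<^sup>2 * (p * q)"] pq assms by (simp add: u_def v_def)
qed

lemma phase_less_pi: "phase a b j < pi"
  unfolding phase_def using arctan_ubound arctan_lbound by (smt (verit) field_sum_of_halves)

lemma phase_pos:
  assumes "0 < a" "0 < b" shows "0 < phase a b j"
  unfolding phase_def using assms by (simp add: arctan_less_iff divide_strict_right_mono)

lemma phase_mono:
  assumes "0 < b" "a \<le> a'" shows "phase a b j \<le> phase a' b j"
  unfolding phase_def using assms by (intro diff_mono) (simp_all add: arctan_le_iff divide_right_mono)

lemma phase_strict_mono:
  assumes "0 < b" "a < a'" shows "phase a b j < phase a' b j"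
  unfolding phase_def using assms
  by (intro diff_strict_mono) (simp_all add: arctan_less_iff divide_strict_right_mono)

lemma cprod_polar:
  fixes a b :: real
  assumes "0 < b"
  shows "\<exists>r>0. fst (cprod (\<lambda>j. (real j + 1 / 2)\<^sup>2 - a\<^sup>2 + b\<^sup>2) (2 * a * b) n) = r * cos (\<Sum>j<n. phase a b j)
     \<and> 2 * a * b * snd (cprod (\<lambda>j. (real j + 1 / 2)\<^sup>2 - a\<^sup>2 + b\<^sup>2) (2 * a * b) n) = r * sin (\<Sum>j<n. phase a b j)"
proof (induction n)
  case 0
  show ?case by (intro exI[of _ 1]) simp
next
  case (Suc n)
  define \<mu> where "\<mu> = 2 * a * b"
  define X Y where "X = fst (cprod (\<lambda>j. (real j + 1 / 2)\<^sup>2 - a\<^sup>2 + b\<^sup>2) \<mu> n)"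
    and "Y = snd (cprod (\<lambda>j. (real j + 1 / 2)\<^sup>2 - a\<^sup>2 + b\<^sup>2) \<mu> n)"
  define \<Phi> where "\<Phi> = (\<Sum>j<n. phase a b j)"
  obtain r where r: "0 < r" "X = r * cos \<Phi>" "\<mu> * Y = r * sin \<Phi>"
    using Suc unfolding X_def Y_def \<Phi>_def \<mu>_def by blast
  define s where "s = (real n + 1 / 2)\<^sup>2 - a\<^sup>2 + b\<^sup>2"
  obtain \<rho> where \<rho>: "0 < \<rho>" "s = \<rho> * cos (phase a b n)" "\<mu> = \<rho> * sin (phase a b n)"
    using arctan_diff_polar[OF assms, of "real n + 1 / 2" a] unfolding s_def \<mu>_def phase_def by metis
  have "s * X - \<mu>\<^sup>2 * Y = s * X - \<mu> * (\<mu> * Y)" by (simp add: power2_eq_square)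
  also have "\<dots> = (\<rho> * r) * cos (\<Phi> + phase a b n)"
    unfolding r(2,3) by (subst \<rho>(2), subst \<rho>(3)) (simp add: cos_add algebra_simps)
  finally have 1: "s * X - \<mu>\<^sup>2 * Y = (\<rho> * r) * cos (\<Phi> + phase a b n)" .
  have "\<mu> * (s * Y + X) = s * (\<mu> * Y) + \<mu> * X" by (simp add: algebra_simps)
  also have "\<dots> = (\<rho> * r) * sin (\<Phi> + phase a b n)"
    unfolding r(2,3) by (subst \<rho>(2), subst \<rho>(3)) (simp add: sin_add algebra_simps)
  finally have "\<mu> * (s * Y + X) = (\<rho> * r) * sin (\<Phi> + phase a b n)" .
  then show ?case
    using 1 \<rho>(1) r(1) unfolding X_def Y_def \<Phi>_def s_def \<mu>_def
    by (intro exI[of _ "\<rho> * r"]) simp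
qed

text \<open>For \<open>a = 1\<close> the two arctangents are two steps apart, so the sum telescopes
  to two terms at either end; the lower two are opposite and cancel.\<close>

lemma sum_phase_1:
  "(\<Sum>j<n. phase 1 b j) = arctan ((real n + 1 / 2) / b) + arctan ((real n - 1 / 2) / b)"
proof (induction n)
  case 0
  have "arctan (- (1 / (2 * b))) = - arctan (1 / (2 * b))" by (rule arctan_minus)
  then show ?case by simp
next
  case (Suc n)
  then show ?case by (simp add: phase_def algebra_simps)
qed

lemma sum_phase_1_less_pi: "(\<Sum>j<n. phase 1 b j) < pi"
  unfolding sum_phase_1 using arctan_ubound by (smt (verit) field_sum_of_halves)

lemma sum_phase_1_tendsto:
  assumes "0 < b"
  shows "(\<lambda>n. \<Sum>j<n. phase 1 b j) \<longlonglongrightarrow> pi"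
proof -
  have "filterlim (\<lambda>n. (real n + c) / b) at_top sequentially" for c
  proof -
    have "filterlim (\<lambda>n. (c + real n) * inverse b) at_top sequentially"
      by (intro filterlim_at_top_mult_tendsto_pos[OF tendsto_const] filterlim_tendsto_add_at_top[OF tendsto_const]
          filterlim_real_sequentially) (use assms in simp)
    then show ?thesis by (simp add: add.commute divide_inverse)
  qed
  from this[of "1 / 2"] this[of "- 1 / 2"]
  have "(\<lambda>n. arctan ((real n + 1 / 2) / b) + arctan ((real n + - 1 / 2) / b)) \<longlonglongrightarrow> pi / 2 + pi / 2"
    by (intro tendsto_add filterlim_compose[OF tendsto_arctan_at_top])
  then show ?thesis unfolding sum_phase_1 by simp
qed

text \<open>For \<open>a > 0\<close> the total argument lies strictly between 0 and
  \<open>pi\<close> by comparison with \<open>a = 1\<close>. For \<open>a = 0\<close> the polar form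
  says nothing about the second component, but all factors are positive reals and induction
  applies.\<close>

lemma snd_cprod_pos:
  assumes "0 \<le> a" "a \<le> 1" "0 < b" "1 \<le> n"
  shows "0 < snd (cprod (\<lambda>j. (real j + 1 / 2)\<^sup>2 - a\<^sup>2 + b\<^sup>2) (2 * a * b) n)"
proof (cases "a = 0")
  case True
  have "0 < fst (cprod (\<lambda>j. (real j + 1 / 2)\<^sup>2 - a\<^sup>2 + b\<^sup>2) (2 * a * b) m) \<and>
    0 \<le> snd (cprod (\<lambda>j. (real j + 1 / 2)\<^sup>2 - a\<^sup>2 + b\<^sup>2) (2 * a * b) m) \<and>
    (1 \<le> m \<longrightarrow> 0 < snd (cprod (\<lambda>j. (real j + 1 / 2)\<^sup>2 - a\<^sup>2 + b\<^sup>2) (2 * a * b) m))" for m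
  proof (induction m)
    case (Suc m)
    have "0 < (real m + 1 / 2)\<^sup>2 + b\<^sup>2" by (intro add_pos_nonneg) auto
    then show ?case using Suc True by (auto intro!: add_nonneg_pos)
  qed simp
  then show ?thesis using assms by blast
next
  case False
  then have a: "0 < a" using assms by simp
  have "0 < (\<Sum>j<n. phase a b j)"
    using assms a by (intro sum_pos phase_pos) (auto simp: lessThan_empty_iff)
  moreover have "(\<Sum>j<n. phase a b j) \<le> (\<Sum>j<n. phase 1 b j)"
    using assms by (intro sum_mono phase_mono)
  ultimately have "0 < sin (\<Sum>j<n. phase a b j)"
    using sum_phase_1_less_pi[of b n] by (intro sin_gt_zero) auto
  then have "0 < 2 * a * b * snd (cprod (\<lambda>j. (real j + 1 / 2)\<^sup>2 - a\<^sup>2 + b\<^sup>2) (2 * a * b) n)"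
    using cprod_polar[OF assms(3), of a n] by (metis mult_pos_pos)
  then show ?thesis by (rule zero_less_mult_pos) (use a assms(3) in simp)
qed

text \<open>At the least \<open>m\<close> where the total argument exceeds \<open>pi\<close> it is
  still below \<open>2 * pi\<close>, because the last phase is less than \<open>pi\<close>; the sine
  is negative there and nonnegative before.\<close>

lemma snd_cprod_first_neg:
  assumes "1 < a" "0 < b"
  obtains n where "1 \<le> n"
    "snd (cprod (\<lambda>j. (real j + 1 / 2)\<^sup>2 - a\<^sup>2 + b\<^sup>2) (2 * a * b) (n + 1)) < 0"
    "\<And>j. j \<le> n \<Longrightarrow> 0 \<le> snd (cprod (\<lambda>j. (real j + 1 / 2)\<^sup>2 - a\<^sup>2 + b\<^sup>2) (2 * a * b) j)"
proof -
  let ?\<Phi> = "\<lambda>n. \<Sum>j<n. phase a b j" and ?Y = "\<lambda>n. snd (cprod (\<lambda>j. (real j + 1 / 2)\<^sup>2 - a\<^sup>2 + b\<^sup>2) (2 * a * b) n)"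
  have ab: "0 < 2 * a * b" using assms by simp
  \<comment> \<open>This excess persists in the sums, since the other phases are at least those for
    \<open>a = 1\<close>, whose sum comes closer to \<open>pi\<close> than the excess.\<close>
  have gap: "phase 1 b 0 < phase a b 0" using assms by (intro phase_strict_mono)
  have "\<exists>n. pi < ?\<Phi> n"
  proof -
    have "\<forall>\<^sub>F n in sequentially. pi - (phase a b 0 - phase 1 b 0) < (\<Sum>j<n. phase 1 b j)"
      using gap by (intro order_tendstoD[OF sum_phase_1_tendsto[OF assms(2)]]) simp
    then obtain n where n: "pi - (phase a b 0 - phase 1 b 0) < (\<Sum>j<Suc n. phase 1 b j)"
      using eventually_sequentially by (metis le_SucI order_refl)
    have "(\<Sum>j<n. phase 1 b (Suc j)) \<le> (\<Sum>j<n. phase a b (Suc j))"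
      using assms by (intro sum_mono phase_mono) auto
    with n have "pi < ?\<Phi> (Suc n)" unfolding sum.lessThan_Suc_shift by simp
    then show ?thesis by blast
  qed
  then obtain m where m: "pi < ?\<Phi> m" "\<And>k. k < m \<Longrightarrow> ?\<Phi> k \<le> pi"
    using exists_least_iff[of "\<lambda>n. pi < ?\<Phi> n"] by (meson not_le)
  \<comment> \<open>A single phase is below \<open>pi\<close>, so at least two are summed.\<close>
  have "m \<noteq> 0" using m(1) by (cases m) auto
  moreover have "m \<noteq> 1" using m(1) phase_less_pi[of a b 0] by auto
  ultimately obtain n where n: "m = n + 1" "1 \<le> n" by (cases m) auto
  have "?\<Phi> m < 2 * pi" using m(2)[of n] n phase_less_pi[of a b n] by simp
  then have "sin (?\<Phi> m) < 0" using m(1) by (intro sin_lt_zero)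
  then have "2 * a * b * ?Y m < 0"
    using cprod_polar[OF assms(2), of a m] by (metis mult_pos_neg)
  then have "\<not> 0 \<le> ?Y m" using ab mult_nonneg_nonneg[of "2 * a * b" "?Y m"] by linarith
  then have "?Y (n + 1) < 0" unfolding n(1) by (simp only: not_le)
  moreover have "0 \<le> ?Y j" if "j \<le> n" for j
  proof -
    have "0 \<le> ?\<Phi> j" using assms by (intro sum_nonneg less_imp_le[OF phase_pos]) auto
    moreover have "?\<Phi> j \<le> pi" using m(2)[of j] that n by simp
    ultimately have "0 \<le> 2 * a * b * ?Y j"
      using cprod_polar[OF assms(2), of a j] by (metis mult_nonneg_nonneg less_imp_le sin_ge_zero)
    then show ?thesis using ab by (simp add: zero_le_mult_iff)
  qed
  ultimately show ?thesis using that n by blast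
qed

section \<open>Leading minors in the eigenvalue basis\<close>

text \<open>Rates of a birth and death process of Hahn type: \<open>J_mat\<close> has
  \<open>up\<close> above the diagonal, \<open>down\<close> below it and
  \<open>\<alpha> + up + down\<close> on it.\<close>

definition up :: "nat \<Rightarrow> real \<Rightarrow> nat \<Rightarrow> real" where
  "up N \<nu> i = (real N - real i) * (real i + \<nu>)"

definition down :: "nat \<Rightarrow> real \<Rightarrow> nat \<Rightarrow> real" where
  "down N \<nu> i = real i * (real N - real i + 2 - \<nu>)"

text \<open>Clearing denominators in the hypergeometric series of the Hahn polynomials gives these connection
  coefficients; for \<open>m = N + 1\<close> the factor \<open>up N \<nu> N = 0\<close> leaves only \<open>j = m\<close>.\<close>

definition conn :: "nat \<Rightarrow> real \<Rightarrow> nat \<Rightarrow> nat \<Rightarrow> real" where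
  "conn N \<nu> m j = real (m choose j) * (\<Prod>i = j..<m. up N \<nu> i)"

lemma conn_eq_0: "m < j \<Longrightarrow> conn N \<nu> m j = 0"
  by (simp add: conn_def binomial_eq_0)

lemma conn_diag [simp]: "conn N \<nu> m m = 1"
  by (simp add: conn_def)

lemma binomial_absorb_real:
  "real (Suc k) * real (k choose j) = (real (Suc k) - real j) * real (Suc k choose j)"
proof (cases "j \<le> k")
  case True
  have "Suc k * (k choose j) = (Suc k - j) * (Suc k choose j)"
    using True by (metis Suc_diff_le binomial_absorb_comp diff_Suc_1)
  then have "real (Suc k) * real (k choose j) = real (Suc k - j) * real (Suc k choose j)"
    by (metis of_nat_mult)
  then show ?thesis using True by (simp add: of_nat_diff)
next
  case False
  then show ?thesis by (cases "j = Suc k") (auto simp: binomial_eq_0)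
qed

text \<open>The three-term recurrence of the leading minors, read off coefficientwise. When the
  factors are \<open>i (i + 1) + \<alpha>\<close>, multiplying the product over \<open>i < j\<close>
  by \<open>\<alpha>\<close> gives the next product minus \<open>j (j + 1)\<close> times the old
  one.\<close>

lemma conn_Suc:
  assumes "j \<le> Suc m"
  shows "conn N \<nu> (Suc m) j = (if j = 0 then 0 else conn N \<nu> m (j - 1))
    + (up N \<nu> m + down N \<nu> m - real j * (real j + 1)) * conn N \<nu> m j
    - up N \<nu> (m - 1) * down N \<nu> m * conn N \<nu> (m - 1) j"
proof (cases "j = Suc m")
  case True
  then show ?thesis by (simp add: conn_eq_0)
next
  case False
  then have j: "j \<le> m" using assms by simp
  \<comment> \<open>All values of \<open>conn\<close> involved become multiples of \<open>Q\<close>;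
    the factor \<open>up N \<nu> (m - 1)\<close> supplies what \<open>conn N \<nu> (m - 1) j\<close>
    lacks.\<close>
  define Q where "Q = (\<Prod>i = j..<m. up N \<nu> i)"
  have 1: "conn N \<nu> (Suc m) j = real (Suc m choose j) * (up N \<nu> m * Q)"
    using j by (simp add: conn_def Q_def prod.atLeastLessThan_Suc mult.commute)
  have 2: "conn N \<nu> m j = real (m choose j) * Q"
    by (simp add: conn_def Q_def)
  have 3: "up N \<nu> (m - 1) * down N \<nu> m * conn N \<nu> (m - 1) j =
      (real N - real m + 2 - \<nu>) * (real m - real j) * real (m choose j) * Q"
  proof (cases m)
    case 0
    then show ?thesis using j by (simp add: down_def)
  next
    case (Suc k)
    have "up N \<nu> k * conn N \<nu> k j = real (k choose j) * Q"
    proof (cases "j \<le> k")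
      case True
      then show ?thesis by (simp add: conn_def Q_def Suc prod.atLeastLessThan_Suc)
    qed (simp add: conn_def)
    then have "up N \<nu> (m - 1) * down N \<nu> m * conn N \<nu> (m - 1) j =
        (real N - real m + 2 - \<nu>) * (real (Suc k) * real (k choose j)) * Q"
      by (simp add: Suc down_def mult_ac)
    then show ?thesis unfolding binomial_absorb_real by (simp add: Suc mult_ac)
  qed
  show ?thesis
  proof (cases j)
    case 0
    then show ?thesis unfolding 1 2 3 by (simp add: down_def algebra_simps)
  next
    case (Suc l)
    have 4: "conn N \<nu> m (j - 1) = real (m choose l) * (up N \<nu> l * Q)"
      using j by (simp add: conn_def Q_def Suc prod.atLeast_Suc_lessThan)
    have 5: "real j * real (m choose j) = (real m - real l) * real (m choose l)"
    proof -
      have "Suc l * (m choose Suc l) = (m - l) * (m choose l)"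
        by (simp only: binomial_absorption binomial_absorb_comp)
      then have "real (Suc l) * real (m choose Suc l) = real (m - l) * real (m choose l)"
        by (metis of_nat_mult)
      then show ?thesis using j Suc by (simp add: of_nat_diff)
    qed
    have 6: "real (Suc m choose j) = real (m choose j) + real (m choose l)"
      by (simp add: Suc)
    have 7: "up N \<nu> m - up N \<nu> l = (real m - real l) * (real N - \<nu> - real m - real l)"
      by (simp add: up_def algebra_simps)
    \<comment> \<open>With Pascal's rule in 6, this is the only relation between the binomial
      coefficients that remains to be used.\<close>
    have "real (m choose l) * (up N \<nu> m - up N \<nu> l) = real j * real (m choose j) * (real N - \<nu> - real m - real l)"
      unfolding 7 5 by (simp add: mult_ac)
    then have "real (Suc m choose j) * up N \<nu> m = real (m choose l) * up N \<nu> l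
        + (up N \<nu> m + down N \<nu> m - real j * (real j + 1)) * real (m choose j)
        - (real N - real m + 2 - \<nu>) * (real m - real j) * real (m choose j)"
      unfolding 6 down_def by (simp add: Suc algebra_simps)
    then have "real (Suc m choose j) * up N \<nu> m * Q = (real (m choose l) * up N \<nu> l
        + (up N \<nu> m + down N \<nu> m - real j * (real j + 1)) * real (m choose j)
        - (real N - real m + 2 - \<nu>) * (real m - real j) * real (m choose j)) * Q"
      by simp
    then show ?thesis unfolding 1 2 3 4 using Suc by (simp add: algebra_simps)
  qed
qed

definition conn_sum :: "nat \<Rightarrow> real \<Rightarrow> (nat \<Rightarrow> real) \<Rightarrow> nat \<Rightarrow> real" where
  "conn_sum N \<nu> f m = (\<Sum>j\<le>m. conn N \<nu> m j * f j)"

lemma conn_sum_Suc: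
  "conn_sum N \<nu> f (Suc m) =
     (\<Sum>j\<le>m. conn N \<nu> m j * (f (Suc j) + (up N \<nu> m + down N \<nu> m - real j * (real j + 1)) * f j))
     - up N \<nu> (m - 1) * down N \<nu> m * conn_sum N \<nu> f (m - 1)"
proof -
  let ?A = "\<lambda>j. up N \<nu> m + down N \<nu> m - real j * (real j + 1)"
  have "conn_sum N \<nu> f (Suc m) = (\<Sum>j\<le>Suc m. (if j = 0 then 0 else conn N \<nu> m (j - 1)) * f j)
      + (\<Sum>j\<le>Suc m. ?A j * conn N \<nu> m j * f j)
      - up N \<nu> (m - 1) * down N \<nu> m * (\<Sum>j\<le>Suc m. conn N \<nu> (m - 1) j * f j)"
    unfolding conn_sum_def sum_distrib_left sum.distrib[symmetric] sum_subtractf[symmetric]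
    by (intro sum.cong refl) (simp add: conn_Suc algebra_simps)
  also have "(\<Sum>j\<le>Suc m. (if j = 0 then 0 else conn N \<nu> m (j - 1)) * f j) =
      (\<Sum>j\<le>m. conn N \<nu> m j * f (Suc j))"
    by (subst sum.atMost_Suc_shift) simp
  also have "(\<Sum>j\<le>Suc m. ?A j * conn N \<nu> m j * f j) = (\<Sum>j\<le>m. ?A j * conn N \<nu> m j * f j)"
    by (simp add: conn_eq_0)
  also have "(\<Sum>j\<le>Suc m. conn N \<nu> (m - 1) j * f j) = conn_sum N \<nu> f (m - 1)"
    unfolding conn_sum_def by (rule sum.mono_neutral_right) (auto simp: conn_eq_0)
  finally show ?thesis
    by (simp add: sum.distrib[symmetric] algebra_simps)
qed

lemma conn_sum_last: "conn_sum N \<nu> f (Suc N) = f (Suc N)"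
proof -
  have "conn N \<nu> (Suc N) j = 0" if "j \<le> N" for j
    using that by (simp add: conn_def prod.atLeastLessThan_Suc up_def)
  then show ?thesis by (simp add: conn_sum_def)
qed

text \<open>The summand at \<open>j = 1\<close> suffices. It is the first usable one, since
  \<open>snd (cprod s \<mu> 0) = 0\<close> and \<open>snd (cprod s \<mu> 1) = 1\<close>.\<close>

lemma conn_sum_pos:
  assumes "0 < \<nu>" "1 \<le> m" "m \<le> N" "\<And>j. j \<le> m \<Longrightarrow> 0 \<le> f j" "0 < f 1"
  shows "0 < conn_sum N \<nu> f m"
proof -
  have c: "0 < conn N \<nu> m j" if "j \<le> m" for j
    unfolding conn_def using assms(1,3) that
    by (intro mult_pos_pos prod_pos) (auto simp: up_def)
  have "0 < conn N \<nu> m 1 * f 1" using c[of 1] assms by simp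
  also have "\<dots> \<le> conn_sum N \<nu> f m"
    unfolding conn_sum_def using assms(2,4) c
    by (intro member_le_sum mult_nonneg_nonneg) (auto simp: less_imp_le)
  finally show ?thesis .
qed

text \<open>\<open>conn_sum\<close> turns the multiplication rule of \<open>cprod\<close> into the
  recurrences that \<open>tridiagonal_square\<close> demands.\<close>

lemma conn_sum_cprod_Suc:
  fixes N :: nat and \<nu> \<mu> \<alpha> :: real
  assumes s: "\<And>j. s j = real j * (real j + 1) + \<alpha>"
  defines "x \<equiv> conn_sum N \<nu> (\<lambda>j. fst (cprod s \<mu> j))"
    and "y \<equiv> conn_sum N \<nu> (\<lambda>j. snd (cprod s \<mu> j))"
    and "p \<equiv> \<lambda>m. \<alpha> + up N \<nu> m + down N \<nu> m"
  shows "x (Suc m) = p m * x m - \<mu>\<^sup>2 * y m - up N \<nu> (m - 1) * down N \<nu> m * x (m - 1)"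
    and "y (Suc m) = p m * y m + x m - up N \<nu> (m - 1) * down N \<nu> m * y (m - 1)"
proof -
  let ?X = "\<lambda>j. fst (cprod s \<mu> j)" and ?Y = "\<lambda>j. snd (cprod s \<mu> j)"
  have "p m * x m - \<mu>\<^sup>2 * y m = (\<Sum>j\<le>m. conn N \<nu> m j * (p m * ?X j - \<mu>\<^sup>2 * ?Y j))"
    unfolding x_def y_def conn_sum_def sum_distrib_left sum_subtractf[symmetric]
    by (intro sum.cong) (simp_all add: algebra_simps)
  also have "\<dots> = (\<Sum>j\<le>m. conn N \<nu> m j * (?X (Suc j) + (up N \<nu> m + down N \<nu> m - real j * (real j + 1)) * ?X j))"
    by (intro sum.cong) (simp_all add: p_def s algebra_simps)
  finally show "x (Suc m) = p m * x m - \<mu>\<^sup>2 * y m - up N \<nu> (m - 1) * down N \<nu> m * x (m - 1)"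
    unfolding x_def by (subst conn_sum_Suc) simp
  have "p m * y m + x m = (\<Sum>j\<le>m. conn N \<nu> m j * (p m * ?Y j + ?X j))"
    unfolding x_def y_def conn_sum_def sum_distrib_left sum.distrib[symmetric]
    by (intro sum.cong) (simp_all add: algebra_simps)
  also have "\<dots> = (\<Sum>j\<le>m. conn N \<nu> m j * (?Y (Suc j) + (up N \<nu> m + down N \<nu> m - real j * (real j + 1)) * ?Y j))"
    by (intro sum.cong) (simp_all add: p_def s algebra_simps)
  finally show "y (Suc m) = p m * y m + x m - up N \<nu> (m - 1) * down N \<nu> m * y (m - 1)"
    unfolding y_def by (subst conn_sum_Suc) simp
qed

section \<open>The sharp range\<close>

lemma K_mat_abs: "K_mat N \<nu> \<bar>a\<bar> b = K_mat N \<nu> a b"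
  by (simp add: K_mat_def)

text \<open>Signs are prescribed only up to \<open>N\<close>: the sign at \<open>N + 1\<close>
  separates the two directions of the theorem.\<close>

locale K_mat_setup =
  fixes N :: nat and \<nu> a b :: real
  assumes \<nu>: "0 < \<nu>" "\<nu> < 2" and a: "0 \<le> a" and b: "0 < b"
    and snd_nonneg: "\<And>j. j \<le> N \<Longrightarrow>
      0 \<le> snd (cprod (\<lambda>j. (real j + 1 / 2)\<^sup>2 - a\<^sup>2 + b\<^sup>2) (2 * a * b) j)"
begin

abbreviation "\<alpha> \<equiv> 1 / 4 - a\<^sup>2 + b\<^sup>2"
abbreviation "\<mu> \<equiv> 2 * a * b"
abbreviation "prods \<equiv> cprod (\<lambda>j. (real j + 1 / 2)\<^sup>2 - a\<^sup>2 + b\<^sup>2) \<mu>"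

definition x where "x = conn_sum N \<nu> (\<lambda>j. fst (prods j))"
definition y where "y = conn_sum N \<nu> (\<lambda>j. snd (prods j))"
definition diag where "diag m = \<alpha> + up N \<nu> m + down N \<nu> m"
text \<open>Shifted so that \<open>up' m\<close> is the entry at \<open>(m - 1, m)\<close>, as
  \<open>tridiagonal_square\<close> expects.\<close>

definition up' where "up' m = (if m = 0 then 0 else up N \<nu> (m - 1))"

lemma y_pos: "1 \<le> m \<Longrightarrow> m \<le> N \<Longrightarrow> 0 < y m"
  unfolding y_def using \<nu> snd_nonneg by (intro conn_sum_pos) auto

lemma y_last: "y (N + 1) = snd (prods (N + 1))" and x_last: "x (N + 1) = fst (prods (N + 1))"
  by (simp_all add: x_def y_def conn_sum_last)

sublocale tridiagonal_square diag up' "down N \<nu>" x y \<mu> N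
proof
  have s: "(real j + 1 / 2)\<^sup>2 - a\<^sup>2 + b\<^sup>2 = real j * (real j + 1) + \<alpha>" for j
    by (simp add: power2_eq_square algebra_simps)
  fix m
  have *: "up' m * down N \<nu> m = up N \<nu> (m - 1) * down N \<nu> m"
    by (simp add: up'_def down_def)
  show "x (Suc m) = diag m * x m - \<mu>\<^sup>2 * y m - up' m * down N \<nu> m * x (m - 1)"
    "y (Suc m) = diag m * y m + x m - up' m * down N \<nu> m * y (m - 1)"
    unfolding * x_def y_def diag_def using conn_sum_cprod_Suc[OF s, of N \<nu> \<mu> m] by simp_all
  show "1 \<le> m \<Longrightarrow> m \<le> N \<Longrightarrow> y m \<noteq> 0" using y_pos by force
  show "1 \<le> m \<Longrightarrow> m \<le> N \<Longrightarrow> 0 < up' m"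
    using \<nu> by (auto simp: up'_def up_def intro!: mult_pos_pos add_nonneg_pos)
  show "1 \<le> m \<Longrightarrow> m \<le> N \<Longrightarrow> 0 < down N \<nu> m"
    using \<nu> by (auto simp: down_def intro!: mult_pos_pos)
qed (simp_all add: up'_def down_def x_def y_def conn_sum_def)

lemma up'_last: "up' (Suc N) = 0"
  by (simp add: up'_def up_def)

text \<open>As \<open>up' (Suc N) = 0\<close>, the recurrence for \<open>W\<close> leaves just the
  squared modulus of the product of all factors.\<close>

lemma W_last: "0 < W (N + 1)"
proof -
  have "(real j + 1 / 2)\<^sup>2 - a\<^sup>2 + b\<^sup>2 \<noteq> 0 \<or> \<mu> \<noteq> 0" for j
  proof (cases "a = 0")
    case True
    have "0 < (real j + 1 / 2)\<^sup>2 + b\<^sup>2" by (intro add_pos_nonneg) auto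
    then show ?thesis using True by simp
  qed (use b in simp)
  then have "0 < (fst (prods (N + 1)))\<^sup>2 + \<mu>\<^sup>2 * (snd (prods (N + 1)))\<^sup>2" by (rule cprod_norm_pos)
  then show ?thesis using W_Suc[of N] x_last y_last up'_last by simp
qed

section \<open>Transfer to the matrices of the theorem\<close>

lemma J_mat_entry:
  "i \<le> N \<Longrightarrow> j \<le> N \<Longrightarrow> J_mat N \<nu> \<alpha> $$ (i, j) = T i j"
  by (auto simp: J_mat_def T_def diag_def up'_def up_def down_def algebra_simps)

lemma K_mat_entry:
  assumes "i \<le> N" "j \<le> N"
  shows "K_mat N \<nu> a b $$ (i, j) = K i j"
proof -
  let ?J = "J_mat N \<nu> \<alpha>"
  have J: "?J \<in> carrier_mat (N + 1) (N + 1)" by (simp add: J_mat_def)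
  have "(?J ^\<^sub>m 2) $$ (i, j) = (\<Sum>k = 0..<N + 1. T i k * T k j)"
  proof -
    have "?J ^\<^sub>m 2 = ?J * ?J" using J by (simp add: numeral_2_eq_2)
    moreover have "(?J * ?J) $$ (i, j) = (\<Sum>k = 0..<N + 1. ?J $$ (i, k) * ?J $$ (k, j))"
      using J assms by (simp add: scalar_prod_def)
    ultimately show ?thesis using assms by (simp add: J_mat_entry)
  qed
  \<comment> \<open>Both borders are harmless: at \<open>i = 0\<close> the truncated index meets
    \<open>down N \<nu> 0 = 0\<close>, and at \<open>i = N\<close> the missing index
    \<open>N + 1\<close> carries \<open>up' (N + 1) = 0\<close>.\<close>
  also have "\<dots> = (\<Sum>k = 0..<N + 1. (if k = i - 1 then down N \<nu> i * T (i - 1) j else 0)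
      + (if k = i then diag i * T i j else 0) + (if k = i + 1 then up' (i + 1) * T (i + 1) j else 0))"
    by (intro sum.cong refl) (auto simp: T_def[of i] d_0)
  also have "\<dots> = down N \<nu> i * T (i - 1) j + diag i * T i j + up' (i + 1) * T (i + 1) j"
    using assms(1) up'_last by (auto simp: sum.distrib not_less le_Suc_eq)
  finally show ?thesis
    using J assms by (simp add: K_mat_def K_def power_mult_distrib pow_carrier_mat)
qed

lemma K_mat_carrier: "K_mat N \<nu> a b \<in> carrier_mat (N + 1) (N + 1)"
  by (simp add: K_mat_def)

lemma K_mat_eq: "K_mat N \<nu> a b = mat (N + 1) (N + 1) (\<lambda>(i, j). K i j)"
  using K_mat_carrier by (intro eq_matI) (auto simp: K_mat_entry)

lemma invertible_K_mat: "invertible_mat (K_mat N \<nu> a b)"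
  using det_K[OF W_last] by (intro invertible_mat_of_det[OF K_mat_carrier]) (simp add: K_mat_eq)

lemma totally_nonnegative_K_mat:
  assumes "0 < snd (prods (N + 1))"
  shows "totally_nonnegative (K_mat N \<nu> a b)"
proof (rule tnn_imp_totally_nonnegative[OF tnn_K K_mat_carrier])
  show "0 < y m" if "1 \<le> m" "m \<le> N + 1" for m
    using that y_pos[of m] assms y_last by (cases "m = N + 1") auto
qed (auto simp: W_last[simplified] K_mat_entry)

lemma not_totally_nonnegative_K_mat:
  assumes "1 \<le> N" "snd (prods (N + 1)) < 0"
  shows "\<not> totally_nonnegative (K_mat N \<nu> a b)"
proof -
  let ?I = "{1..N}" and ?J = "{..<N}"
  have sel: "{i. i < N + 1 \<and> i \<in> ?I} = ?I" "{j. j < N + 1 \<and> j \<in> ?J} = ?J" by auto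
  have pick: "pick ?I i = Suc i" "pick ?J i = i" if "i < N" for i
  proof -
    have "{k \<in> ?I. k < Suc i} = {1..i}" "{k \<in> ?J. k < i} = {..<i}" using that by auto
    then show "pick ?I i = Suc i" "pick ?J i = i"
      using pick_card_in_set[of "Suc i" ?I] pick_card_in_set[of i ?J] that by auto
  qed
  have dims: "dim_row (K_mat N \<nu> a b) = N + 1" "dim_col (K_mat N \<nu> a b) = N + 1"
    using K_mat_carrier by auto
  have "submatrix (K_mat N \<nu> a b) ?I ?J = mat N N (\<lambda>(i, j). K (Suc i) j)"
    unfolding submatrix_def dims sel card_atLeastAtMost card_lessThan
    by (rule eq_matI) (simp_all add: K_mat_entry pick[unfolded One_nat_def])
  moreover have "det (mat N N (\<lambda>(i, j). K (Suc i) j)) < 0"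
    using assms y_pos y_last by (intro det_K_corner_neg) auto
  moreover have "?I \<subseteq> {..<dim_row (K_mat N \<nu> a b)}" "?J \<subseteq> {..<dim_col (K_mat N \<nu> a b)}"
    unfolding dims by auto
  ultimately show ?thesis
    unfolding totally_nonnegative_def by (metis card_atLeastAtMost card_lessThan diff_Suc_1 not_less)
qed

end

theorem theorem4p8:
  shows "(\<forall>(\<nu>::real) (b::real) (a::real). 0 < \<nu> \<and> \<nu> < 2 \<and> b > 0 \<and> \<bar>a\<bar> \<le> 1 \<longrightarrow>
            (\<forall>N::nat. invertible_mat (K_mat N \<nu> a b) \<and> totally_nonnegative (K_mat N \<nu> a b)))
       \<and> (\<forall>(a::real) (b::real) (\<nu>::real). \<bar>a\<bar> > 1 \<and> b > 0 \<and> 0 < \<nu> \<and> \<nu> < 2 \<longrightarrow>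
            (\<exists>N::nat. \<not> totally_nonnegative (K_mat N \<nu> a b)))
       \<and> (\<forall>b::real. b > 0 \<longrightarrow>
            {a::real. \<forall>(\<nu>::real) (N::nat). 0 < \<nu> \<and> \<nu> < 2 \<longrightarrow> totally_nonnegative (K_mat N \<nu> a b)}
              = {a. \<bar>a\<bar> \<le> 1})"
proof -
  have pos: "invertible_mat (K_mat N \<nu> a b) \<and> totally_nonnegative (K_mat N \<nu> a b)"
    if "0 < \<nu>" "\<nu> < 2" "b > 0" "\<bar>a\<bar> \<le> 1" for \<nu> a b :: real and N
  proof -
    have snd_pos: "0 < snd (cprod (\<lambda>j. (real j + 1 / 2)\<^sup>2 - \<bar>a\<bar>\<^sup>2 + b\<^sup>2) (2 * \<bar>a\<bar> * b) j)" if "1 \<le> j" for j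
      using that \<open>b > 0\<close> \<open>\<bar>a\<bar> \<le> 1\<close> by (intro snd_cprod_pos) auto
    interpret K_mat_setup N \<nu> "\<bar>a\<bar>" b
    proof
      show "0 \<le> snd (cprod (\<lambda>j. (real j + 1 / 2)\<^sup>2 - \<bar>a\<bar>\<^sup>2 + b\<^sup>2) (2 * \<bar>a\<bar> * b) j)" for j
        using snd_pos[of j] by (cases "j = 0") auto
    qed (use that in auto)
    show ?thesis
      using invertible_K_mat totally_nonnegative_K_mat[OF snd_pos] by (simp add: K_mat_abs)
  qed
  have neg: "\<exists>N. \<not> totally_nonnegative (K_mat N \<nu> a b)"
    if "\<bar>a\<bar> > 1" "b > 0" "0 < \<nu>" "\<nu> < 2" for a b \<nu> :: real
  proof -
    obtain N where N: "1 \<le> N"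
      "snd (cprod (\<lambda>j. (real j + 1 / 2)\<^sup>2 - \<bar>a\<bar>\<^sup>2 + b\<^sup>2) (2 * \<bar>a\<bar> * b) (N + 1)) < 0"
      "\<And>j. j \<le> N \<Longrightarrow> 0 \<le> snd (cprod (\<lambda>j. (real j + 1 / 2)\<^sup>2 - \<bar>a\<bar>\<^sup>2 + b\<^sup>2) (2 * \<bar>a\<bar> * b) j)"
      using snd_cprod_first_neg[OF \<open>1 < \<bar>a\<bar>\<close> \<open>0 < b\<close>] by blast
    interpret K_mat_setup N \<nu> "\<bar>a\<bar>" b
      by unfold_locales (rule that N(3) abs_ge_zero | assumption)+
    show ?thesis
      using not_totally_nonnegative_K_mat[OF N(1,2)] by (auto simp: K_mat_abs)
  qed
  \<comment> \<open>A single admissible \<open>\<nu>\<close>, here 1, is enough to exclude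
    \<open>\<bar>a\<bar> > 1\<close>.\<close>
  have "\<bar>a\<bar> \<le> 1" if "b > 0" "\<forall>\<nu> N. 0 < \<nu> \<and> \<nu> < 2 \<longrightarrow> totally_nonnegative (K_mat N \<nu> a b)" for a b :: real
    using neg[of a b 1] that by (force simp: not_le)
  then have "{a. \<forall>\<nu> N. 0 < \<nu> \<and> \<nu> < 2 \<longrightarrow> totally_nonnegative (K_mat N \<nu> a b)} = {a. \<bar>a\<bar> \<le> 1}"
    if "b > 0" for b :: real
    using that pos by blast
  then show ?thesis using pos neg by blast
qed

end
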